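(* Let $G$ be a threshold graph on $\{0,1,\dots,n\}$ labeled by reverse degree sequence, with edges directed from $i$ to $j$ when $i>j$, degree sequence $(d_0,\dots,d_n)$, and let $\mathbf a=(a_1,\dots,a_n)\in\mathbb Z_{>0}^n$. Then \[\operatorname{Ehr}_{q,q^{-1}}(\mathcal F_G(\mathbf a))=q^{-F}\prod_{i=1}^n b_i(q),\] where $F=\sum_{i=1}^n\min\{d_i,i\}\,a_i-n$ and \[b_i(q)=\begin{cases}[(i+1)a_i+\sum_{j=i+1}^{d_i}a_j]_q&\text{if }d_i>i,\\ [a_i]_{q^{i+1}}&\text{if }d_i=i,\\ [a_i]_{q^{d_i+1}}[d_i]_q&\text{if }d_i<i.\end{cases}\]
   Context: A threshold graph is built from one vertex by repeatedly adding a dominating vertex or an isolated vertex; labeled by reverse degree sequence means $d_i\ge d_j$ for $i<j$. $\mathcal F_G(\mathbf a)$ is the set of $x\in\mathbb R_{\ge0}^E$ such that for each vertex $k\ge1$ the flow out of $k$ (on edges to smaller vertices) minus the flow into $k$ equals $a_k$, and the net flow at $0$ is $-\sum a_i$. $wt_{q,t}(b)=\frac{q^b-t^b}{q-t}$ for $b>0$, $wt_{q,t}(0)=1$; for an integer flow $A=(a_{ij})$, $wt_{q,t}(A)=(-(1-t)(1-q))^{\#\{a_{ij}>0\}-n}\prod wt_{q,t}(a_{ij})$; $\operatorname{Ehr}_{q,t}(\mathcal F_G(\mathbf a))=\sum_{A\in\mathcal F_G(\mathbf a)\cap\mathbb Z^E}wt_{q,t}(A)$, here evaluated at $t=q^{-1}$.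 $[k]_x=1+x+\dots+x^{k-1}$. *)

theory Defs
  imports Complex_Main "HOL-Library.FuncSet"
begin

inductive threshold_graph :: "'v set \<Rightarrow> 'v set set \<Rightarrow> bool" where
  single: "threshold_graph {v} {}"
| isolated: "threshold_graph V E \<Longrightarrow> v \<notin> V \<Longrightarrow> threshold_graph (insert v V) E"
| dominating: "threshold_graph V E \<Longrightarrow> v \<notin> V \<Longrightarrow>
    threshold_graph (insert v V) (E \<union> {{u, v} |u. u \<in> V})"

definition vertex_degree :: "'v set set \<Rightarrow> 'v \<Rightarrow> nat" where
  "vertex_degree E v = card {e \<in> E. v \<in> e}"

definition directed_edges :: "nat set set \<Rightarrow> (nat \<times> nat) set" where
  "directed_edges E = {(i, j). j < i \<and> {i, j} \<in> E}"

definition net_flow :: "(nat \<times> nat) set \<Rightarrow> (nat \<times> nat \<Rightarrow> real) \<Rightarrow> nat \<Rightarrow> real" where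
  "net_flow D x k = (\<Sum>j | (k, j) \<in> D. x (k, j)) - (\<Sum>i | (i, k) \<in> D. x (i, k))"

text \<open>Points of \<open>\<real>\<^sup>D\<close> are extensional functions on \<open>D\<close>, so each flow is counted once.\<close>

definition flow_polytope ::
    "nat \<Rightarrow> (nat \<times> nat) set \<Rightarrow> (nat \<Rightarrow> real) \<Rightarrow> (nat \<times> nat \<Rightarrow> real) set" where
  "flow_polytope n D a =
     {x \<in> D \<rightarrow>\<^sub>E {0..}. (\<forall>k\<in>{1..n}. net_flow D x k = a k) \<and>
        net_flow D x 0 = - (\<Sum>i=1..n. a i)}"

definition edge_wt :: "'a::field \<Rightarrow> 'a \<Rightarrow> nat \<Rightarrow> 'a" where
  "edge_wt q t b = (if b = 0 then 1 else (q ^ b - t ^ b) / (q - t))"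

text \<open>Used only for \<open>x\<close> with nonnegative integer entries on \<open>D\<close>, where
  \<open>nat \<lfloor>x e\<rfloor>\<close> is the entry itself as a natural number.\<close>

definition flow_wt ::
    "'a::field \<Rightarrow> 'a \<Rightarrow> nat \<Rightarrow> (nat \<times> nat) set \<Rightarrow> (nat \<times> nat \<Rightarrow> real) \<Rightarrow> 'a" where
  "flow_wt q t n D x =
     (- ((1 - t) * (1 - q))) powi (int (card {e \<in> D. x e > 0}) - int n) *
     (\<Prod>e\<in>D. edge_wt q t (nat \<lfloor>x e\<rfloor>))"

definition Ehr :: "'a::field \<Rightarrow> 'a \<Rightarrow> nat \<Rightarrow> (nat \<times> nat) set \<Rightarrow> (nat \<Rightarrow> real) \<Rightarrow> 'a" where
  "Ehr q t n D a = (\<Sum>x \<in> flow_polytope n D a \<inter> (D \<rightarrow>\<^sub>E \<int>). flow_wt q t n D x)"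

definition qint :: "'a::comm_semiring_1 \<Rightarrow> nat \<Rightarrow> 'a" where
  "qint x k = (\<Sum>j<k. x ^ j)"

definition b_factor :: "'a::field \<Rightarrow> (nat \<Rightarrow> nat) \<Rightarrow> (nat \<Rightarrow> nat) \<Rightarrow> nat \<Rightarrow> 'a" where
  "b_factor q d a i =
     (if d i > i then qint q ((i + 1) * a i + (\<Sum>j=i+1..d i. a j))
      else if d i = i then qint (q ^ (i + 1)) (a i)
      else qint (q ^ (d i + 1)) (a i) * qint q (d i))"

end

theory Submission
  imports Defs "HOL-Computational_Algebra.Polynomial" "HOL-Computational_Algebra.Formal_Power_Series"
begin

text \<open>
  Sorted by degree, a threshold graph has the out-neighbourhoods \<open>{0..<r i}\<close> with \<open>r i = min (d i) i\<close>,
  and deleting the last vertex keeps this shape. One therefore peels off the last vertex: with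
  \<open>m = r n\<close>, its outflow is distributed as \<open>f\<close> over the vertices \<open>0..<m\<close>, and the product formula
  for the smaller graph is summed over \<open>f\<close>. Up to powers of \<open>q\<close>, an edge has the generating function
  \<open>(1 - q z)\<^sup>2 / ((1 - z) (1 - q\<^sup>2 z))\<close>, so that a product of such series at \<open>z, q z, q\<^sup>2 z, \<dots>\<close>
  telescopes. Expanding the \<open>m - 1\<close> factors \<open>[A\<^sub>j + \<dots>]\<^sub>q\<close> as differences of powers
  of \<open>q\<close>, the term of each subset \<open>S\<close> is such a telescoping product, whose exponents form a window
  of \<open>m\<close> consecutive integers starting at \<open>card S\<close>; it thus depends on \<open>S\<close> only through \<open>card S\<close>,
  and the terms reassemble to \<open>\<Prod>j. [A\<^sub>j + a\<^sub>n]\<^sub>q\<close>.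
\<close>

section \<open>Telescoping generating functions\<close>

lemma qint_0 [simp]: "qint x 0 = 0"
  by (simp add: qint_def)

lemma qint_Suc [simp]: "qint x (Suc k) = qint x k + x ^ k"
  by (simp add: qint_def)

lemma qint_geometric:
  fixes x :: "'a::comm_ring_1"
  shows "(x - 1) * qint x k = x ^ k - 1"
  by (induction k) (simp_all add: algebra_simps)

lemma qint_mult:
  fixes x :: "'a::comm_semiring_1"
  shows "qint x (k * l) = qint x k * qint (x ^ k) l"
proof (induction l)
  case (Suc l)
  have add: "qint x (i + j) = qint x i + x ^ i * qint x j" for i j
    by (induction j) (simp_all add: algebra_simps power_add)
  show ?case
    using Suc add[of "k * l" k]
    by (simp add: algebra_simps power_mult)
qed simp

text \<open>The generating function \<open>(1 - q\<^sup>s\<^sup>+\<^sup>1 z) (1 - q\<^sup>s\<^sup>+\<^sup>m z) / ((1 - q\<^sup>s z) (1 - q\<^sup>s\<^sup>+\<^sup>m\<^sup>+\<^sup>1 z))\<close>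
  of the window of exponents \<open>s..<s + m\<close>; a single edge is the case \<open>m = 1\<close>.\<close>

definition window_fps :: "'a::idom \<Rightarrow> nat \<Rightarrow> nat \<Rightarrow> 'a fps" where
  "window_fps q m s =
     Abs_fps (\<lambda>N. if N = 0 then 1 else (q - 1) * (q ^ m - 1) * q ^ (s * N) * qint (q ^ (m + 1)) N)"

lemma window_fps_0 [simp]: "window_fps q 0 s = 1"
  by (rule fps_ext) (simp add: window_fps_def)

text \<open>Since \<open>qint p (k + 1) - qint p k = p ^ k\<close>, the first linear factor leaves a
  shifted geometric series of ratio \<open>r * p\<close>, which the second one sums.\<close>

lemma qint_fps_mult:
  fixes r p :: "'a::comm_ring_1"
  shows "Abs_fps (\<lambda>N. r ^ N * qint p N) *
    ((1 - fps_const r * fps_X) * (1 - fps_const (r * p) * fps_X)) = fps_const r * fps_X"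
    (is "?g * (?u * ?v) = _")
proof -
  have "?g * ?u = fps_const r * fps_X * Abs_fps (\<lambda>N. (r * p) ^ N)"
  proof (rule fps_ext)
    fix N
    show "fps_nth (?g * ?u) N = fps_nth (fps_const r * fps_X * Abs_fps (\<lambda>N. (r * p) ^ N)) N"
      by (cases N) (simp_all add: algebra_simps power_mult_distrib mult.assoc)
  qed
  moreover have "Abs_fps (\<lambda>N. (r * p) ^ N) * ?v = 1"
  proof (rule fps_ext)
    fix N
    show "fps_nth (Abs_fps (\<lambda>N. (r * p) ^ N) * ?v) N = fps_nth 1 N"
      by (cases N) (simp_all add: algebra_simps)
  qed
  ultimately show ?thesis
    by (simp add: mult.assoc[symmetric]) (simp add: mult.assoc)
qed

abbreviation lin_fps :: "'a::idom \<Rightarrow> nat \<Rightarrow> 'a fps" where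
  "lin_fps q s \<equiv> 1 - fps_const (q ^ s) * fps_X"

lemma lin_fps_nonzero: "lin_fps q s \<noteq> 0"
proof
  assume "lin_fps q s = 0"
  then have "fps_nth (lin_fps q s) 0 = 0" by (metis fps_zero_nth)
  then show False by simp
qed

text \<open>Denominators are cleared, so an integral domain suffices. Numerator and denominator
  differ only in their linear coefficients, by \<open>(q - 1) * (q ^ m - 1) * q ^ s\<close>.\<close>

lemma window_fps_rational:
  "window_fps q m s * (lin_fps q s * lin_fps q (s + m + 1)) =
    lin_fps q (s + 1) * lin_fps q (s + m)"
proof -
  let ?g = "Abs_fps (\<lambda>N. (q ^ s) ^ N * qint (q ^ (m + 1)) N)"
  let ?x = "(q - 1) * (q ^ m - 1)"
  let ?D = "lin_fps q s * lin_fps q (s + m + 1)"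
  have w: "window_fps q m s = 1 + fps_const ?x * ?g"
    by (rule fps_ext) (simp add: window_fps_def power_mult mult.assoc)
  have "?g * ?D = fps_const (q ^ s) * fps_X"
    using qint_fps_mult[of "q ^ s" "q ^ (m + 1)"] by (simp add: power_add mult_ac)
  then have "window_fps q m s * ?D = ?D + fps_const ?x * (fps_const (q ^ s) * fps_X)"
    by (simp only: w distrib_right mult_1_left mult.assoc)
  also have "\<dots> = lin_fps q (s + 1) * lin_fps q (s + m)"
    by (simp add: algebra_simps power_add fps_const_add[symmetric] fps_const_sub[symmetric]
        fps_const_mult[symmetric] del: fps_const_add fps_const_sub fps_const_mult)
  finally show ?thesis .
qed

text \<open>Adjacent windows merge: the linear factors with exponents \<open>s + m\<close> and
  \<open>s + m + 1\<close> occur once above and once below. The common denominator \<open>D\<close>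
  is cancelled at the end.\<close>

lemma window_fps_mult:
  "window_fps q m s * window_fps q l (s + m) = window_fps q (m + l) s"
proof -
  let ?L = "lin_fps q"
  define D where "D = ?L s * ?L (s + m + 1) * (?L (s + m) * ?L (s + m + l + 1))"
  have "window_fps q m s * window_fps q l (s + m) * D =
     (window_fps q m s * (?L s * ?L (s + m + 1))) *
     (window_fps q l (s + m) * (?L (s + m) * ?L (s + m + l + 1)))"
    by (simp only: D_def mult_ac)
  also have "\<dots> = (?L (s + 1) * ?L (s + m)) * (?L (s + m + 1) * ?L (s + m + l))"
    by (simp only: window_fps_rational)
  also have "\<dots> = window_fps q (m + l) s * (?L s * ?L (s + (m + l) + 1)) * (?L (s + m) * ?L (s + m + 1))"
    by (simp only: window_fps_rational[of q "m + l"]) (simp only: mult_ac add.assoc)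
  also have "\<dots> = window_fps q (m + l) s * D"
    by (simp only: D_def mult_ac add.assoc)
  finally show ?thesis
    using lin_fps_nonzero[of q] unfolding D_def by (metis mult_cancel_right mult_eq_0_iff)
qed

text \<open>Reading \<open>k\<close> upwards, each \<open>k \<in> S\<close> extends the window by one at the top, and each
  \<open>k \<notin> S\<close> by one at the bottom.\<close>

lemma prod_window_fps:
  assumes "m \<le> M + 1" "0 \<notin> S" "finite S"
  shows "(\<Prod>k<m. window_fps q 1 ((M - k) + (if k \<in> S then k + 1 else 0) + card (S \<inter> {..<k}))) =
    window_fps q m (M + 1 - m + card (S \<inter> {..<m}))"
  using assms(1)
proof (induction m)
  case (Suc m)
  let ?s = "card (S \<inter> {..<m})"
  show ?case
  proof (cases "m \<in> S")
    case True
    have "S \<inter> {..<Suc m} = insert m (S \<inter> {..<m})" using True by auto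
    then have c: "card (S \<inter> {..<Suc m}) = Suc ?s" by simp
    show ?thesis
      using Suc True window_fps_mult[of q m "M + 1 - m + ?s" 1]
      by (simp add: c Suc_diff_le)
  next
    case False
    have "S \<inter> {..<Suc m} = S \<inter> {..<m}" using False by (auto simp: less_Suc_eq)
    then show ?thesis
      using Suc False window_fps_mult[of q 1 "M - m + ?s" m]
      by (simp add: Suc_diff_le mult.commute)
  qed
qed simp

section \<open>Weak compositions and coefficients of products of power series\<close>

definition compositions :: "nat \<Rightarrow> nat \<Rightarrow> (nat \<Rightarrow> nat) set" where
  "compositions m N = {f \<in> {..<m} \<rightarrow>\<^sub>E UNIV. sum f {..<m} = N}"

lemma finite_compositions [simp]: "finite (compositions m N)"
proof (rule finite_subset)
  show "compositions m N \<subseteq> {..<m} \<rightarrow>\<^sub>E {..N}"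
  proof
    fix f assume f: "f \<in> compositions m N"
    have "f j \<le> N" if "j < m" for j
      using f that member_le_sum[of j "{..<m}" f] by (auto simp: compositions_def)
    then show "f \<in> {..<m} \<rightarrow>\<^sub>E {..N}"
      using f by (auto simp: compositions_def PiE_iff)
  qed
qed (simp add: finite_PiE)

text \<open>The last part is written \<open>N - i\<close> to match the Cauchy product; the inverse
  resets it to \<open>undefined\<close> because compositions are extensional.\<close>

lemma compositions_Suc:
  "bij_betw (\<lambda>(i, f). f(m := N - i)) (SIGMA i:{0..N}. compositions m i) (compositions (Suc m) N)"
proof (rule bij_betw_byWitness[where f' = "\<lambda>f. (N - f m, f(m := undefined))"])
  show "\<forall>a\<in>SIGMA i:{0..N}. compositions m i.
      (\<lambda>f. (N - f m, f(m := undefined))) ((\<lambda>(i, f). f(m := N - i)) a) = a"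
    by (auto simp: compositions_def PiE_iff extensional_def fun_eq_iff)
  show "\<forall>f\<in>compositions (Suc m) N. (\<lambda>(i, f). f(m := N - i)) (N - f m, f(m := undefined)) = f"
    by (auto simp: compositions_def fun_eq_iff)
  show "(\<lambda>(i, f). f(m := N - i)) ` (SIGMA i:{0..N}. compositions m i) \<subseteq> compositions (Suc m) N"
  proof clarsimp
    fix i f assume "i \<le> N" and f: "f \<in> compositions m i"
    have "sum (f(m := N - i)) {..<m} = sum f {..<m}" by (rule sum.cong) auto
    then show "f(m := N - i) \<in> compositions (Suc m) N"
      using \<open>i \<le> N\<close> f by (auto simp: compositions_def PiE_iff extensional_def)
  qed
  show "(\<lambda>f. (N - f m, f(m := undefined))) ` compositions (Suc m) N \<subseteq> (SIGMA i:{0..N}. compositions m i)"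
  proof clarsimp
    fix f assume f: "f \<in> compositions (Suc m) N"
    have "sum (f(m := undefined)) {..<m} = sum f {..<m}" by (rule sum.cong) auto
    then show "f(m := undefined) \<in> compositions m (N - f m)"
      using f by (auto simp: compositions_def PiE_iff extensional_def)
  qed
qed

text \<open>Iterating the Cauchy product turns a sum over all distributions of \<open>N\<close>
  units among \<open>m\<close> edges into a single coefficient.\<close>

lemma fps_nth_prod:
  fixes G :: "nat \<Rightarrow> 'a::comm_ring_1 fps"
  shows "fps_nth (\<Prod>k<m. G k) N = (\<Sum>f\<in>compositions m N. \<Prod>k<m. fps_nth (G k) (f k))"
proof (induction m arbitrary: N)
  case 0
  have "compositions 0 N = (if N = 0 then {\<lambda>_. undefined} else {})"
    by (auto simp: compositions_def)
  then show ?case by simp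
next
  case (Suc m)
  have "fps_nth (\<Prod>k<Suc m. G k) N =
      (\<Sum>i=0..N. \<Sum>f\<in>compositions m i. (\<Prod>k<m. fps_nth (G k) (f k)) * fps_nth (G m) (N - i))"
    by (simp add: fps_mult_nth Suc.IH sum_distrib_right)
  also have "\<dots> = (\<Sum>(i, f)\<in>(SIGMA i:{0..N}. compositions m i).
      (\<Prod>k<m. fps_nth (G k) (f k)) * fps_nth (G m) (N - i))"
    by (simp add: sum.Sigma)
  also have "\<dots> = (\<Sum>(i, f)\<in>(SIGMA i:{0..N}. compositions m i).
      \<Prod>k<Suc m. fps_nth (G k) ((f(m := N - i)) k))"
    by (rule sum.cong) (auto intro!: prod.cong)
  also have "\<dots> = (\<Sum>f\<in>compositions (Suc m) N. \<Prod>k<Suc m. fps_nth (G k) (f k))"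
    using sum.reindex_bij_betw[OF compositions_Suc, of "\<lambda>f. \<Prod>k<Suc m. fps_nth (G k) (f k)" m N]
    by (simp add: case_prod_unfold)
  finally show ?case .
qed

text \<open>For \<open>b > 0\<close> this is \<open>- (1 - q) (1 - 1/q) q\<^sup>b\<close> times the edge weight of \<open>b\<close>.\<close>

definition reduced_wt :: "'a::comm_ring_1 \<Rightarrow> nat \<Rightarrow> 'a" where
  "reduced_wt q b = (if b = 0 then 1 else (q - 1) ^ 2 * qint (q ^ 2) b)"

section \<open>Summation over the outflow of one vertex\<close>

lemma fps_nth_window_fps_1: "fps_nth (window_fps q 1 s) b = reduced_wt q b * q ^ (s * b)"
  by (simp add: window_fps_def reduced_wt_def power2_eq_square mult_ac)

text \<open>Collecting by \<open>k\<close>: the entry \<open>f k\<close> is counted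
  \<open>k + 1\<close> times for \<open>j = k \<in> S\<close> and once for every
  \<open>j \<in> S\<close> below \<open>k\<close>. In this form the power of \<open>q\<close> splits
  into one factor per edge.\<close>

lemma sum_subset_exponents:
  fixes f :: "nat \<Rightarrow> nat"
  assumes "S \<subseteq> {..<m}"
  shows "(\<Sum>j\<in>S. (j + 1) * f j + (\<Sum>k\<in>{j<..<m}. f k)) =
    (\<Sum>k<m. ((if k \<in> S then k + 1 else 0) + card (S \<inter> {..<k})) * f k)"
proof -
  have fin: "finite S" using assms finite_subset by blast
  have "(\<Sum>j\<in>S. \<Sum>k\<in>{j<..<m}. f k) = (\<Sum>j\<in>S. \<Sum>k | k \<in> {..<m} \<and> j < k. f k)"
    by (intro sum.cong) auto
  also have "\<dots> = (\<Sum>k<m. \<Sum>j | j \<in> S \<and> j < k. f k)"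
    using fin by (intro sum.swap_restrict) auto
  also have "\<dots> = (\<Sum>k<m. card (S \<inter> {..<k}) * f k)"
    by (intro sum.cong) (auto simp: Int_def)
  finally have 1: "(\<Sum>j\<in>S. \<Sum>k\<in>{j<..<m}. f k) = (\<Sum>k<m. card (S \<inter> {..<k}) * f k)" .
  have "(\<Sum>j\<in>S. (j + 1) * f j) = (\<Sum>k<m. (if k \<in> S then k + 1 else 0) * f k)"
    using assms by (intro sum.mono_neutral_cong_left) auto
  with 1 show ?thesis
    by (simp add: sum.distrib distrib_right)
qed

text \<open>Once the summand is a product over edges, the sum is a coefficient of a product of
  windows of length one. These merge into one window of length \<open>m\<close>, which remembers
  only \<open>card S\<close>.\<close>

lemma composition_sum_subset:
  fixes q :: "'a::idom"
  assumes "S \<subseteq> {1..<m}" "N > 0" "m > 0"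
  shows "(\<Sum>f\<in>compositions m N. (\<Prod>k<m. reduced_wt q (f k) * q ^ ((m - 1 - k) * f k)) *
      (\<Prod>j\<in>S. q ^ ((j + 1) * f j + (\<Sum>k\<in>{j<..<m}. f k)))) =
    (q - 1) ^ 2 * qint q m * qint (q ^ (m + 1)) N * (q ^ N) ^ card S"
proof -
  define e where "e k = (if k \<in> S then k + 1 else 0) + card (S \<inter> {..<k})" for k
  have S: "S \<subseteq> {..<m}" "finite S" "0 \<notin> S" "S \<inter> {..<m} = S"
    using assms(1) by (auto intro: finite_subset[OF assms(1)])
  have "(\<Prod>k<m. reduced_wt q (f k) * q ^ ((m - 1 - k) * f k)) *
      (\<Prod>j\<in>S. q ^ ((j + 1) * f j + (\<Sum>k\<in>{j<..<m}. f k))) =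
      (\<Prod>k<m. fps_nth (window_fps q 1 (m - 1 - k + e k)) (f k))" for f
  proof -
    have "(\<Prod>j\<in>S. q ^ ((j + 1) * f j + (\<Sum>k\<in>{j<..<m}. f k))) = (\<Prod>k<m. q ^ (e k * f k))"
      unfolding power_sum[symmetric] sum_subset_exponents[OF S(1)] e_def ..
    then show ?thesis
      unfolding fps_nth_window_fps_1
      by (simp only: prod.distrib[symmetric] power_add distrib_right mult.assoc)
  qed
  then have "(\<Sum>f\<in>compositions m N. (\<Prod>k<m. reduced_wt q (f k) * q ^ ((m - 1 - k) * f k)) *
      (\<Prod>j\<in>S. q ^ ((j + 1) * f j + (\<Sum>k\<in>{j<..<m}. f k)))) =
      fps_nth (\<Prod>k<m. window_fps q 1 (m - 1 - k + e k)) N"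
    by (simp add: fps_nth_prod)
  \<comment> \<open>With \<open>M = m - 1\<close> the lowest exponent
    \<open>M + 1 - m + card S\<close> is just \<open>card S\<close>.\<close>
  also have "(\<Prod>k<m. window_fps q 1 (m - 1 - k + e k)) = window_fps q m (card S)"
    using prod_window_fps[of m "m - 1" S q] S assms(3) unfolding e_def by (simp add: add.assoc)
  finally show ?thesis
    using assms(2) qint_geometric[of q m, symmetric]
    by (simp add: window_fps_def power2_eq_square power_mult[symmetric] mult.commute[of N] mult.assoc)
qed

text \<open>Multiplied by \<open>q - 1\<close>, each \<open>q\<close>-integer becomes a power of
  \<open>q\<close> minus 1, and the product expands over subsets. For every subset, summing over
  \<open>f\<close> replaces the exponents coming from \<open>f\<close> by \<open>N\<close>, up to a
  common factor \<open>K\<close>.\<close>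

lemma composition_sum:
  fixes q :: "'a::idom"
  assumes "q \<noteq> 1" "N > 0"
  shows "(\<Sum>f\<in>compositions m N. (\<Prod>k<m. reduced_wt q (f k) * q ^ ((m - 1 - k) * f k)) *
      (\<Prod>j\<in>{1..<m}. qint q (A j + (j + 1) * f j + (\<Sum>k\<in>{j<..<m}. f k)))) =
    (q - 1) ^ 2 * qint q m * qint (q ^ (m + 1)) N * (\<Prod>j\<in>{1..<m}. qint q (A j + N))"
proof (cases "m = 0")
  case True
  \<comment> \<open>Without outgoing edges nothing can carry \<open>N > 0\<close>, and the
    right-hand side vanishes through \<open>qint q 0\<close>.\<close>
  then have "compositions m N = {}" using assms(2) by (auto simp: compositions_def)
  then show ?thesis using True by simp
next
  case False
  let ?J = "{1..<m}"
  let ?C = "compositions m N"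
  define P where "P f = (\<Prod>k<m. reduced_wt q (f k) * q ^ ((m - 1 - k) * f k))" for f
  define g where "g f j = (j + 1) * f j + (\<Sum>k\<in>{j<..<m}. f k)" for f :: "nat \<Rightarrow> nat" and j
  define K where "K = (q - 1) ^ 2 * qint q m * qint (q ^ (m + 1)) N"
  \<comment> \<open>General in \<open>h\<close>, as it is read forwards with \<open>h = g f\<close>
    and backwards with \<open>h\<close> constantly \<open>N\<close>.\<close>
  have expand: "(q - 1) ^ card ?J * (\<Prod>j\<in>?J. qint q (A j + h j)) =
      (\<Sum>S\<in>Pow ?J. (\<Prod>j\<in>S. q ^ A j) * (\<Prod>j\<in>S. q ^ h j) * (- 1) ^ card (?J - S))" for h
  proof -
    have "(q - 1) ^ card ?J * (\<Prod>j\<in>?J. qint q (A j + h j)) = (\<Prod>j\<in>?J. q ^ A j * q ^ h j + - 1)"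
      by (simp only: prod_constant[symmetric] prod.distrib[symmetric] qint_geometric power_add)
        simp
    then show ?thesis
      by (simp only: prod_add[OF finite_atLeastLessThan] prod_constant prod.distrib)
  qed
  have "(q - 1) ^ card ?J * (\<Sum>f\<in>?C. P f * (\<Prod>j\<in>?J. qint q (A j + g f j))) =
      (\<Sum>f\<in>?C. P f * ((q - 1) ^ card ?J * (\<Prod>j\<in>?J. qint q (A j + g f j))))"
    by (simp add: sum_distrib_left mult_ac)
  also have "\<dots> = (\<Sum>S\<in>Pow ?J. (\<Prod>j\<in>S. q ^ A j) * (- 1) ^ card (?J - S) *
      (\<Sum>f\<in>?C. P f * (\<Prod>j\<in>S. q ^ g f j)))"
    unfolding expand sum_distrib_left by (subst sum.swap) (simp only: mult_ac)
  also have "\<dots> = (\<Sum>S\<in>Pow ?J. K * ((\<Prod>j\<in>S. q ^ A j) * (\<Prod>j\<in>S. q ^ N) * (- 1) ^ card (?J - S)))"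
  proof (rule sum.cong)
    fix S assume "S \<in> Pow ?J"
    then have "(\<Sum>f\<in>?C. P f * (\<Prod>j\<in>S. q ^ g f j)) = K * (\<Prod>j\<in>S. q ^ N)"
      using composition_sum_subset[of S m N q] False assms(2)
      by (simp add: P_def g_def K_def)
    then show "(\<Prod>j\<in>S. q ^ A j) * (- 1) ^ card (?J - S) * (\<Sum>f\<in>?C. P f * (\<Prod>j\<in>S. q ^ g f j)) =
        K * ((\<Prod>j\<in>S. q ^ A j) * (\<Prod>j\<in>S. q ^ N) * (- 1) ^ card (?J - S))"
      by (simp only: mult_ac)
  qed simp
  also have "\<dots> = (q - 1) ^ card ?J * (K * (\<Prod>j\<in>?J. qint q (A j + N)))"
    unfolding sum_distrib_left[symmetric] expand[of "\<lambda>_. N", symmetric] by (simp only: mult_ac)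
  finally show ?thesis
    using assms(1) by (simp add: P_def g_def K_def add.assoc)
qed

text \<open>When the last vertex is dominating, the identity is the previous one divided by \<open>[m + 1]\<^sub>q\<close>,
  which may vanish in the field; hence the division is done for an indeterminate \<open>q\<close>.\<close>

lemma composition_sum_full:
  fixes q :: "'a::idom"
  assumes "N > 0"
  shows "(\<Sum>f\<in>compositions (Suc m) N.
      (\<Prod>k<Suc m. reduced_wt q (f k) * q ^ ((m - k) * f k)) *
      ((\<Prod>j\<in>{1..<m}. qint q (A j + (j + 1) * f j + (\<Sum>k\<in>{j<..<Suc m}. f k))) *
        (if m = 0 then 1 else qint (q ^ (m + 1)) (b + f m)))) =
    (q - 1) ^ 2 * qint (q ^ (m + 2)) N * (\<Prod>j\<in>{1..<Suc m}. qint q ((A(m := (m + 1) * b)) j + N))"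
    (is "?l q = ?r q")
proof -
  define X :: "'a poly" where "X = [:0, 1:]"
  define L :: "'a poly" where "L = (\<Sum>f\<in>compositions (Suc m) N.
      (\<Prod>k<Suc m. reduced_wt X (f k) * X ^ ((m - k) * f k)) *
      ((\<Prod>j\<in>{1..<m}. qint X (A j + (j + 1) * f j + (\<Sum>k\<in>{j<..<Suc m}. f k))) *
        (if m = 0 then 1 else qint (X ^ (m + 1)) (b + f m))))"
  define R :: "'a poly" where
    "R = (X - 1) ^ 2 * qint (X ^ (m + 2)) N * (\<Prod>j\<in>{1..<Suc m}. qint X ((A(m := (m + 1) * b)) j + N))"
  have poly_qint: "poly (qint p k) q = qint (poly p q) k" for p :: "'a poly" and k q
    by (simp add: qint_def poly_sum)
  have poly_wt: "poly (reduced_wt X k) q = reduced_wt q k" for k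
    by (simp add: reduced_wt_def poly_qint X_def)
  have "poly L q = ?l q"
    unfolding L_def poly_sum poly_mult poly_prod poly_power poly_wt poly_qint
    by (cases "m = 0") (simp_all add: X_def poly_qint)
  moreover have "poly R q = ?r q"
    unfolding R_def poly_mult poly_prod poly_power poly_qint
    by (simp add: X_def)
  moreover have "L = R"
  proof -
    \<comment> \<open>The constant term 1 makes this polynomial nonzero in every characteristic,
      hence cancellable.\<close>
    have "poly (qint X (Suc m)) 0 = 1"
      unfolding poly_qint by (induction m) (simp_all add: X_def)
    then have nz: "qint X (Suc m) \<noteq> 0" by (metis poly_0 zero_neq_one)
    have "X \<noteq> 1" by (simp add: X_def one_pCons)
    \<comment> \<open>The new factor merges with \<open>qint (X ^ (m + 1)) (b + f m)\<close> into
      \<open>qint X (Suc m * (b + f m))\<close>, the factor \<open>j = m\<close> that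
      \<open>composition_sum\<close> requires; hence the value \<open>(m + 1) * b\<close> of
      \<open>A\<close> at \<open>m\<close>.\<close>
    have "qint X (Suc m) * L = qint X (Suc m) * R"
    proof (cases "m = 0")
      case True
      then show ?thesis
        using composition_sum[OF \<open>X \<noteq> 1\<close> assms, of 1] by (simp add: L_def R_def eval_nat_numeral)
    next
      case False
      then have J: "{1..<Suc m} = insert m {1..<m}" by auto
      have "qint X (Suc m) * L = (\<Sum>f\<in>compositions (Suc m) N.
        (\<Prod>k<Suc m. reduced_wt X (f k) * X ^ (((Suc m) - 1 - k) * f k)) *
        (\<Prod>j\<in>{1..<Suc m}. qint X ((A(m := (m + 1) * b)) j + (j + 1) * f j + (\<Sum>k\<in>{j<..<Suc m}. f k))))"
        unfolding L_def sum_distrib_left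
      proof (rule sum.cong)
        fix f
        have empty: "{m<..<Suc m} = {}" by auto
        have *: "(\<Prod>j\<in>{1..<Suc m}. qint X ((A(m := (m + 1) * b)) j + (j + 1) * f j + (\<Sum>k\<in>{j<..<Suc m}. f k))) =
          qint X (Suc m * (b + f m)) * (\<Prod>j\<in>{1..<m}. qint X (A j + (j + 1) * f j + (\<Sum>k\<in>{j<..<Suc m}. f k)))"
          unfolding J using empty by (simp add: distrib_left add_ac)
        show "qint X (Suc m) *
           ((\<Prod>k<Suc m. reduced_wt X (f k) * X ^ ((m - k) * f k)) *
            ((\<Prod>j\<in>{1..<m}. qint X (A j + (j + 1) * f j + (\<Sum>k\<in>{j<..<Suc m}. f k))) *
             (if m = 0 then 1 else qint (X ^ (m + 1)) (b + f m)))) =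
          (\<Prod>k<Suc m. reduced_wt X (f k) * X ^ ((Suc m - 1 - k) * f k)) *
          (\<Prod>j\<in>{1..<Suc m}. qint X ((A(m := (m + 1) * b)) j + (j + 1) * f j + (\<Sum>k\<in>{j<..<Suc m}. f k)))"
          unfolding * qint_mult[of X "Suc m"] using False by (simp add: mult_ac)
      qed simp
      then show ?thesis
        unfolding composition_sum[OF \<open>X \<noteq> 1\<close> assms] R_def by (simp add: mult_ac)
    qed
    then show ?thesis using nz by simp
  qed
  ultimately show ?thesis by metis
qed

section \<open>Flows on shifted graphs\<close>

text \<open>The out-neighbourhood of \<open>i\<close> is \<open>{..<r i}\<close>. By the second
  condition, an out-neighbour of \<open>i\<close> below \<open>k\<close> is also one of
  \<open>k\<close>, for every \<open>k < i\<close>.\<close>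

definition shifted :: "nat \<Rightarrow> (nat \<Rightarrow> nat) \<Rightarrow> bool" where
  "shifted n r \<longleftrightarrow> (\<forall>i\<le>n. r i \<le> i) \<and> (\<forall>i\<le>n. \<forall>k<i. min (r i) k \<le> r k)"

definition shifted_edges :: "nat \<Rightarrow> (nat \<Rightarrow> nat) \<Rightarrow> (nat \<times> nat) set" where
  "shifted_edges n r = (SIGMA i:{..n}. {..<r i})"

definition in_nbrs :: "nat \<Rightarrow> (nat \<Rightarrow> nat) \<Rightarrow> nat \<Rightarrow> nat set" where
  "in_nbrs n r k = {i. i \<le> n \<and> k < r i}"

text \<open>Conservation is additive to stay within the naturals. The balance at vertex 0 follows
  from the others, see \<open>sum_net_flow\<close>.\<close>

definition nat_flows :: "nat \<Rightarrow> (nat \<Rightarrow> nat) \<Rightarrow> (nat \<Rightarrow> nat) \<Rightarrow> (nat \<times> nat \<Rightarrow> nat) set" where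
  "nat_flows n r a = {x \<in> shifted_edges n r \<rightarrow>\<^sub>E UNIV.
     \<forall>k\<in>{1..n}. (\<Sum>j<r k. x (k, j)) = a k + (\<Sum>i\<in>in_nbrs n r k. x (i, k))}"

text \<open>The product formula phrased by in-neighbours instead of degrees, because these sets
  change simply when the last vertex is removed. \<open>b_factor_shifted\<close> translates
  back.\<close>

definition shifted_factor :: "'a::comm_ring_1 \<Rightarrow> nat \<Rightarrow> (nat \<Rightarrow> nat) \<Rightarrow> (nat \<Rightarrow> nat) \<Rightarrow> nat \<Rightarrow> 'a" where
  "shifted_factor q n r a i =
     (if in_nbrs n r i \<noteq> {} then qint q ((i + 1) * a i + (\<Sum>k\<in>in_nbrs n r i. a k))
      else if r i = i then qint (q ^ (i + 1)) (a i)
      else qint (q ^ (r i + 1)) (a i) * qint q (r i))"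

lemma finite_in_nbrs [simp]: "finite (in_nbrs n r k)"
  by (rule finite_subset[of _ "{..n}"]) (auto simp: in_nbrs_def)

lemma in_nbrs_Suc:
  "in_nbrs (Suc n) r k = (if k < r (Suc n) then insert (Suc n) (in_nbrs n r k) else in_nbrs n r k)"
  by (auto simp: in_nbrs_def le_Suc_eq)

lemma Suc_notin_in_nbrs [simp]: "Suc n \<notin> in_nbrs n r k"
  by (simp add: in_nbrs_def)

lemma shifted_edges_Suc:
  "shifted_edges (Suc n) r = shifted_edges n r \<union> Pair (Suc n) ` {..<r (Suc n)}"
  by (auto simp: shifted_edges_def le_Suc_eq)

lemma finite_shifted_edges [simp]: "finite (shifted_edges n r)"
  by (simp add: shifted_edges_def)

lemma shifted_Suc: "shifted (Suc n) r \<Longrightarrow> shifted n r"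
  by (simp add: shifted_def)

lemma shifted_le: "shifted n r \<Longrightarrow> i \<le> n \<Longrightarrow> r i \<le> i"
  by (simp add: shifted_def)

text \<open>A vertex that receives an edge sends edges to all smaller vertices, because here
  \<open>min (r i) j = j\<close>.\<close>

lemma shifted_out_eq:
  assumes "shifted n r" "i \<le> n" "j < r i"
  shows "r j = j"
proof -
  have "r i \<le> i" using assms(1,2) by (simp add: shifted_def)
  then have "j < i" "j \<le> n" using assms by auto
  then have "min (r i) j \<le> r j" "r j \<le> j"
    using assms(1,2) by (simp_all add: shifted_def)
  then show ?thesis using assms(3) by simp
qed

text \<open>An edge from the last vertex to \<open>i\<close> forces one from every vertex in
  between.\<close>

lemma shifted_in_nbrs:
  assumes "shifted (Suc n) r" "i < r (Suc n)"
  shows "in_nbrs n r i = {i<..n}"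
proof -
  have 1: "i < r k" if "i < k" "k \<le> n" for k
  proof -
    have "min (r (Suc n)) k \<le> r k"
      using assms(1) that by (simp add: shifted_def)
    then show ?thesis using assms(2) that by linarith
  qed
  have 2: "i < k" if "i < r k" "k \<le> n" for k
    using shifted_le[OF assms(1), of k] that by linarith
  have "k \<in> in_nbrs n r i \<longleftrightarrow> k \<in> {i<..n}" for k
    using 1[of k] 2[of k] by (auto simp: in_nbrs_def)
  then show ?thesis by blast
qed

abbreviation add_inflow :: "nat \<Rightarrow> (nat \<Rightarrow> nat) \<Rightarrow> (nat \<Rightarrow> nat) \<Rightarrow> nat \<Rightarrow> nat" where
  "add_inflow m a f \<equiv> \<lambda>k. if k < m then a k + f k else a k"

text \<open>No edge enters the last vertex, so its outflow is an arbitrary composition of its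
  supply. On the smaller graph this outflow acts as additional supply at the heads of the removed
  edges.\<close>

lemma nat_flows_Suc:
  assumes "shifted (Suc n) r"
  shows "bij_betw (\<lambda>(f, y) (i, j). if i = Suc n then f j else y (i, j))
    (SIGMA f:compositions (r (Suc n)) (a (Suc n)). nat_flows n r (add_inflow (r (Suc n)) a f))
    (nat_flows (Suc n) r a)"
proof -
  let ?m = "r (Suc n)"
  let ?S = "SIGMA f:compositions ?m (a (Suc n)). nat_flows n r (add_inflow ?m a f)"
  let ?\<Phi> = "\<lambda>(f, y) (i, j). if i = Suc n then f j else y (i, j)"
  let ?\<Psi> = "\<lambda>x. ((\<lambda>j. x (Suc n, j)), (\<lambda>(i, j). if i = Suc n then undefined else x (i, j)))"
  have nbr: "i \<noteq> Suc n" if "i \<in> in_nbrs n r k" for i k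
    using that by auto
  have last: "in_nbrs (Suc n) r (Suc n) = {}"
    using shifted_le[OF assms] unfolding in_nbrs_def
    by (metis (mono_tags, lifting) Collect_empty_eq leD le_trans)
  have Ball_Suc: "(\<forall>k\<in>{1..Suc n}. P k) \<longleftrightarrow> (\<forall>k\<in>{1..n}. P k) \<and> P (Suc n)" for P
    by (auto simp: atLeastAtMostSuc_conv)
  have inflow: "(\<Sum>i\<in>in_nbrs (Suc n) r k. x (i, k)) =
      (if k < ?m then x (Suc n, k) else 0) + (\<Sum>i\<in>in_nbrs n r k. x (i, k))"
    for x :: "nat \<times> nat \<Rightarrow> nat" and k
    by (simp add: in_nbrs_Suc)
  \<comment> \<open>Stated for any \<open>f\<close> and \<open>y\<close> that agree with
    \<open>x\<close>, so that it serves both directions of the bijection.\<close>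
  have conserve: "(\<forall>k\<in>{1..Suc n}. (\<Sum>j<r k. x (k, j)) = a k + (\<Sum>i\<in>in_nbrs (Suc n) r k. x (i, k))) \<longleftrightarrow>
      (\<forall>k\<in>{1..n}. (\<Sum>j<r k. y (k, j)) = add_inflow ?m a f k + (\<Sum>i\<in>in_nbrs n r k. y (i, k))) \<and>
      sum f {..<?m} = a (Suc n)"
    if f: "\<And>j. f j = x (Suc n, j)" and y: "\<And>i j. i \<noteq> Suc n \<Longrightarrow> y (i, j) = x (i, j)"
    for x y :: "nat \<times> nat \<Rightarrow> nat" and f
  proof -
    have "(\<Sum>i\<in>in_nbrs n r k. y (i, k)) = (\<Sum>i\<in>in_nbrs n r k. x (i, k))" for k
      by (rule sum.cong) (auto intro: y)
    moreover have "(\<Sum>j<r k. y (k, j)) = (\<Sum>j<r k. x (k, j))" if "k \<in> {1..n}" for k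
      using that by (intro sum.cong y) auto
    ultimately show ?thesis
      unfolding Ball_Suc using last by (auto simp: inflow f)
  qed
  show ?thesis
  proof (rule bij_betw_byWitness[where f' = ?\<Psi>])
    show "\<forall>p\<in>?S. ?\<Psi> (?\<Phi> p) = p"
      by (auto simp: fun_eq_iff nat_flows_def PiE_iff extensional_def shifted_edges_def)
    show "\<forall>x\<in>nat_flows (Suc n) r a. ?\<Phi> (?\<Psi> x) = x"
      by (auto simp: fun_eq_iff)
    show "?\<Phi> ` ?S \<subseteq> nat_flows (Suc n) r a"
    proof clarify
      fix f y assume f: "f \<in> compositions ?m (a (Suc n))" and y: "y \<in> nat_flows n r (add_inflow ?m a f)"
      let ?x = "\<lambda>(i, j). if i = Suc n then f j else y (i, j)"
      have "?x \<in> shifted_edges (Suc n) r \<rightarrow>\<^sub>E UNIV"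
        using f y by (auto simp: compositions_def nat_flows_def PiE_iff extensional_def shifted_edges_def le_Suc_eq)
      moreover have "\<forall>k\<in>{1..Suc n}. (\<Sum>j<r k. ?x (k, j)) = a k + (\<Sum>i\<in>in_nbrs (Suc n) r k. ?x (i, k))"
        using f y by (subst conserve[of f ?x y]) (auto simp: compositions_def nat_flows_def)
      ultimately show "?x \<in> nat_flows (Suc n) r a"
        by (simp add: nat_flows_def)
    qed
    show "?\<Psi> ` nat_flows (Suc n) r a \<subseteq> ?S"
    proof clarify
      fix x assume x: "x \<in> nat_flows (Suc n) r a"
      let ?f = "\<lambda>j. x (Suc n, j)" and ?y = "\<lambda>(i, j). if i = Suc n then undefined else x (i, j)"
      have "?f \<in> {..<?m} \<rightarrow>\<^sub>E UNIV" "?y \<in> shifted_edges n r \<rightarrow>\<^sub>E UNIV"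
        using x by (auto simp: nat_flows_def PiE_iff extensional_def shifted_edges_def le_Suc_eq)
      moreover have "(\<forall>k\<in>{1..n}. (\<Sum>j<r k. ?y (k, j)) = add_inflow ?m a ?f k + (\<Sum>i\<in>in_nbrs n r k. ?y (i, k))) \<and>
          sum ?f {..<?m} = a (Suc n)"
        using x by (subst conserve[of ?f x ?y, symmetric]) (auto simp: nat_flows_def)
      ultimately show "?f \<in> compositions ?m (a (Suc n)) \<and> ?y \<in> nat_flows n r (add_inflow ?m a ?f)"
        by (simp add: compositions_def nat_flows_def)
    qed
  qed
qed

lemma finite_nat_flows [simp]: "shifted n r \<Longrightarrow> finite (nat_flows n r a)"
proof (induction n arbitrary: a)
  case 0
  then have "shifted_edges 0 r = {}" by (auto simp: shifted_def shifted_edges_def)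
  then have "nat_flows 0 r a \<subseteq> {\<lambda>_. undefined}" by (auto simp: nat_flows_def)
  then show ?case using finite_subset by blast
next
  case (Suc n)
  then show ?case
    using bij_betw_finite[OF nat_flows_Suc[OF Suc.prems, of a]] shifted_Suc by (auto intro!: finite_SigmaI)
qed

text \<open>The exponent \<open>r i - 1 - j\<close> absorbs the power \<open>q\<^sup>-\<^sup>x\<close> of each edge weight: see the potential
  identity \<open>nat_flows_potential\<close> below.\<close>

definition shifted_wt :: "'a::comm_ring_1 \<Rightarrow> (nat \<Rightarrow> nat) \<Rightarrow> (nat \<times> nat \<Rightarrow> nat) \<Rightarrow> nat \<times> nat \<Rightarrow> 'a" where
  "shifted_wt q r x = (\<lambda>(i, j). reduced_wt q (x (i, j)) * q ^ ((r i - 1 - j) * x (i, j)))"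

lemma sum_nat_flows_Suc:
  fixes q :: "'a::comm_ring_1"
  assumes "shifted (Suc n) r"
  defines "m \<equiv> r (Suc n)"
  shows "(\<Sum>x\<in>nat_flows (Suc n) r a. \<Prod>e\<in>shifted_edges (Suc n) r. shifted_wt q r x e) =
    (\<Sum>f\<in>compositions m (a (Suc n)). (\<Prod>k<m. reduced_wt q (f k) * q ^ ((m - 1 - k) * f k)) *
      (\<Sum>y\<in>nat_flows n r (add_inflow m a f). \<Prod>e\<in>shifted_edges n r. shifted_wt q r y e))"
proof -
  let ?E = "shifted_edges n r" and ?E' = "shifted_edges (Suc n) r"
  let ?S = "SIGMA f:compositions m (a (Suc n)). nat_flows n r (add_inflow m a f)"
  let ?\<Phi> = "\<lambda>(f, y) (i, j). if i = Suc n then f j else y (i, j)"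
  have split: "(\<Prod>e\<in>?E'. shifted_wt q r (?\<Phi> (f, y)) e) =
    (\<Prod>k<m. reduced_wt q (f k) * q ^ ((m - 1 - k) * f k)) * (\<Prod>e\<in>?E. shifted_wt q r y e)" for f y
  proof -
    have "(\<Prod>e\<in>?E'. shifted_wt q r (?\<Phi> (f, y)) e) = (\<Prod>e\<in>?E. shifted_wt q r (?\<Phi> (f, y)) e) *
        (\<Prod>e\<in>Pair (Suc n) ` {..<m}. shifted_wt q r (?\<Phi> (f, y)) e)"
      unfolding shifted_edges_Suc m_def
      by (rule prod.union_disjoint) (auto simp: shifted_edges_def)
    also have "(\<Prod>e\<in>?E. shifted_wt q r (?\<Phi> (f, y)) e) = (\<Prod>e\<in>?E. shifted_wt q r y e)"
      by (rule prod.cong) (auto simp: shifted_wt_def shifted_edges_def)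
    also have "(\<Prod>e\<in>Pair (Suc n) ` {..<m}. shifted_wt q r (?\<Phi> (f, y)) e) =
        (\<Prod>k<m. reduced_wt q (f k) * q ^ ((m - 1 - k) * f k))"
      by (subst prod.reindex) (auto simp: shifted_wt_def m_def inj_on_def)
    finally show ?thesis by (simp only: mult.commute)
  qed
  have "(\<Sum>x\<in>nat_flows (Suc n) r a. \<Prod>e\<in>?E'. shifted_wt q r x e) =
      (\<Sum>p\<in>?S. \<Prod>e\<in>?E'. shifted_wt q r (?\<Phi> p) e)"
    using sum.reindex_bij_betw[OF nat_flows_Suc[OF assms(1), of a],
        of "\<lambda>x. \<Prod>e\<in>?E'. shifted_wt q r x e"]
    unfolding m_def by simp
  also have "\<dots> = (\<Sum>(f, y)\<in>?S. (\<Prod>k<m. reduced_wt q (f k) * q ^ ((m - 1 - k) * f k)) *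
      (\<Prod>e\<in>?E. shifted_wt q r y e))"
    using split by (intro sum.cong) auto
  also have "\<dots> = (\<Sum>f\<in>compositions m (a (Suc n)). \<Sum>y\<in>nat_flows n r (add_inflow m a f).
      (\<Prod>k<m. reduced_wt q (f k) * q ^ ((m - 1 - k) * f k)) * (\<Prod>e\<in>?E. shifted_wt q r y e))"
    using shifted_Suc[OF assms(1)] by (subst sum.Sigma) auto
  finally show ?thesis by (simp add: sum_distrib_left)
qed

text \<open>Only the factors of vertices \<open>i < m\<close> depend on \<open>f\<close>; for
  \<open>i \<ge> m\<close> the in-neighbours exceed \<open>i\<close> and gain no supply. The
  dominating case \<open>m = Suc n\<close> is separate: in the smaller graph vertex \<open>n\<close>
  has no in-neighbour, so its factor has base \<open>q ^ (n + 1)\<close>.\<close>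

lemma composition_sum_shifted_factor:
  fixes q :: "'a::idom"
  assumes sh: "shifted (Suc n) r" and "q \<noteq> 1" and pos: "a (Suc n) > 0"
  defines "m \<equiv> r (Suc n)"
  shows "(\<Sum>f\<in>compositions m (a (Suc n)). (\<Prod>k<m. reduced_wt q (f k) * q ^ ((m - 1 - k) * f k)) *
      (\<Prod>i\<in>{1..n}. shifted_factor q n r (add_inflow m a f) i)) =
    (q - 1) ^ 2 * (\<Prod>i\<in>{1..Suc n}. shifted_factor q (Suc n) r a i)"
proof -
  let ?N = "a (Suc n)"
  define A where "A j = (j + 1) * a j + (\<Sum>k\<in>{j<..n}. a k)" for j
  have m: "m \<le> Suc n" using shifted_le[OF sh, of "Suc n"] by (simp add: m_def)
  have last: "in_nbrs (Suc n) r (Suc n) = {}"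
    using shifted_le[OF sh] unfolding in_nbrs_def
    by (metis (mono_tags, lifting) Collect_empty_eq leD le_trans)
  have low': "shifted_factor q (Suc n) r a i = qint q (A i + ?N)" if "i < m" for i
    using shifted_in_nbrs[OF sh, of i] that
    by (simp add: shifted_factor_def in_nbrs_Suc m_def A_def add_ac)
  \<comment> \<open>\<open>i < n\<close> ensures an in-neighbour in the smaller graph, hence the
    first case of \<open>shifted_factor\<close>.\<close>
  have low: "shifted_factor q n r (add_inflow m a f) i =
      qint q (A i + (i + 1) * f i + (\<Sum>k\<in>{i<..<m}. f k))" if "i < m" "i < n" for i f
  proof -
    have "(\<Sum>k\<in>{i<..n}. add_inflow m a f k) =
        (\<Sum>k\<in>{i<..n}. a k + (if k < m then f k else 0))"
      by (rule sum.cong) auto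
    also have "\<dots> = (\<Sum>k\<in>{i<..n}. a k) + (\<Sum>k\<in>{i<..n}. if k < m then f k else 0)"
      by (rule sum.distrib)
    also have "(\<Sum>k\<in>{i<..n}. if k < m then f k else 0) = (\<Sum>k\<in>{i<..<m}. f k)"
      using m by (intro sum.mono_neutral_cong_right) auto
    finally show ?thesis
      using shifted_in_nbrs[OF sh, of i] that
      by (simp add: shifted_factor_def m_def A_def algebra_simps)
  qed
  have high: "shifted_factor q n r (add_inflow m a f) i = shifted_factor q (Suc n) r a i"
    if "\<not> i < m" "i \<le> n" for i f
  proof -
    have nb: "in_nbrs (Suc n) r i = in_nbrs n r i" using that by (simp add: in_nbrs_Suc m_def)
    have "i < k" if "k \<in> in_nbrs n r i" for k
      using shifted_le[OF sh, of k] that by (simp add: in_nbrs_def)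
    then have "(\<Sum>k\<in>in_nbrs n r i. add_inflow m a f k) = (\<Sum>k\<in>in_nbrs n r i. a k)"
      using that(1) by (intro sum.cong) force+
    then show ?thesis using that(1) by (simp add: shifted_factor_def nb)
  qed
  show ?thesis
  proof (cases "m = Suc n")
    case False
    then have "m \<le> n" using m by simp
    \<comment> \<open>The \<open>max\<close> covers \<open>m = 0\<close>, as the factors start at
      index 1.\<close>
    then have J: "{1..n} = {1..<m} \<union> {max 1 m..n}" "{1..Suc n} = insert (Suc n) ({1..<m} \<union> {max 1 m..n})"
      by auto
    define H where "H = (\<Prod>i\<in>{max 1 m..n}. shifted_factor q (Suc n) r a i)"
    have prod_n: "(\<Prod>i\<in>{1..n}. shifted_factor q n r (add_inflow m a f) i) =
      (\<Prod>j\<in>{1..<m}. qint q (A j + (j + 1) * f j + (\<Sum>k\<in>{j<..<m}. f k))) * H" for f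
    proof -
      have "(\<Prod>i\<in>{1..n}. shifted_factor q n r (add_inflow m a f) i) =
        (\<Prod>i\<in>{1..<m}. shifted_factor q n r (add_inflow m a f) i) *
        (\<Prod>i\<in>{max 1 m..n}. shifted_factor q n r (add_inflow m a f) i)"
        unfolding J by (rule prod.union_disjoint) auto
      also have "(\<Prod>i\<in>{max 1 m..n}. shifted_factor q n r (add_inflow m a f) i) = H"
        unfolding H_def by (rule prod.cong) (auto intro!: high)
      also have "(\<Prod>i\<in>{1..<m}. shifted_factor q n r (add_inflow m a f) i) =
        (\<Prod>j\<in>{1..<m}. qint q (A j + (j + 1) * f j + (\<Sum>k\<in>{j<..<m}. f k)))"
        using \<open>m \<le> n\<close> by (intro prod.cong refl low) auto
      finally show ?thesis .
    qed
    have "(\<Prod>i\<in>{1..Suc n}. shifted_factor q (Suc n) r a i) =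
        shifted_factor q (Suc n) r a (Suc n) * (\<Prod>i\<in>{1..<m} \<union> {max 1 m..n}. shifted_factor q (Suc n) r a i)"
      unfolding J by (rule prod.insert) (use \<open>m \<le> n\<close> in auto)
    also have "(\<Prod>i\<in>{1..<m} \<union> {max 1 m..n}. shifted_factor q (Suc n) r a i) =
        (\<Prod>i\<in>{1..<m}. shifted_factor q (Suc n) r a i) * H"
      unfolding H_def by (rule prod.union_disjoint) auto
    also have "(\<Prod>i\<in>{1..<m}. shifted_factor q (Suc n) r a i) = (\<Prod>j\<in>{1..<m}. qint q (A j + ?N))"
      by (intro prod.cong refl low') auto
    also have "shifted_factor q (Suc n) r a (Suc n) = qint (q ^ (m + 1)) ?N * qint q m"
      using False by (simp add: shifted_factor_def last m_def)
    finally have prod_Suc: "(\<Prod>i\<in>{1..Suc n}. shifted_factor q (Suc n) r a i) =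
      qint (q ^ (m + 1)) ?N * qint q m * ((\<Prod>j\<in>{1..<m}. qint q (A j + ?N)) * H)" .
    show ?thesis
      unfolding prod_n prod_Suc mult.assoc[symmetric] sum_distrib_right[symmetric]
        composition_sum[OF \<open>q \<noteq> 1\<close> pos]
      by (simp only: mult_ac)
  next
    case True
    have prod_n: "(\<Prod>i\<in>{1..n}. shifted_factor q n r (add_inflow m a f) i) =
      (\<Prod>j\<in>{1..<n}. qint q (A j + (j + 1) * f j + (\<Sum>k\<in>{j<..<Suc n}. f k))) *
        (if n = 0 then 1 else qint (q ^ (n + 1)) (a n + f n))" for f
    proof (cases "n = 0")
      case False
      then have "{1..n} = insert n {1..<n}" by auto
      then have "(\<Prod>i\<in>{1..n}. shifted_factor q n r (add_inflow m a f) i) =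
          (\<Prod>i\<in>{1..<n}. shifted_factor q n r (add_inflow m a f) i) * shifted_factor q n r (add_inflow m a f) n"
        by (simp add: mult.commute)
      also have "(\<Prod>i\<in>{1..<n}. shifted_factor q n r (add_inflow m a f) i) =
          (\<Prod>j\<in>{1..<n}. qint q (A j + (j + 1) * f j + (\<Sum>k\<in>{j<..<Suc n}. f k)))"
        using low True by (intro prod.cong refl) auto
      also have "shifted_factor q n r (add_inflow m a f) n = qint (q ^ (n + 1)) (a n + f n)"
        using True shifted_in_nbrs[OF sh, of n] shifted_out_eq[OF sh, of "Suc n" n]
        by (simp add: shifted_factor_def m_def)
      finally show ?thesis using False by simp
    qed simp
    have "{1..Suc n} = insert (Suc n) {1..<Suc n}" by auto
    then have "(\<Prod>i\<in>{1..Suc n}. shifted_factor q (Suc n) r a i) =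
        shifted_factor q (Suc n) r a (Suc n) * (\<Prod>i\<in>{1..<Suc n}. shifted_factor q (Suc n) r a i)"
      by simp
    \<comment> \<open>\<open>A n\<close> is already \<open>(n + 1) * a n\<close>, its interval being
      empty; the update only fits the shape of \<open>composition_sum_full\<close>.\<close>
    also have "(\<Prod>i\<in>{1..<Suc n}. shifted_factor q (Suc n) r a i) =
        (\<Prod>j\<in>{1..<Suc n}. qint q ((A(n := (n + 1) * a n)) j + ?N))"
    proof (rule prod.cong)
      fix j assume "j \<in> {1..<Suc n}"
      then show "shifted_factor q (Suc n) r a j = qint q ((A(n := (n + 1) * a n)) j + ?N)"
        using low'[of j] True by (auto simp: A_def)
    qed simp
    also have "shifted_factor q (Suc n) r a (Suc n) = qint (q ^ (n + 2)) ?N"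
      using True by (simp add: shifted_factor_def last m_def)
    finally have prod_Suc: "(\<Prod>i\<in>{1..Suc n}. shifted_factor q (Suc n) r a i) =
      qint (q ^ (n + 2)) ?N * (\<Prod>j\<in>{1..<Suc n}. qint q ((A(n := (n + 1) * a n)) j + ?N))" .
    show ?thesis
      unfolding prod_n prod_Suc unfolding True
      using composition_sum_full[OF pos, where m = n and q = q and A = A and b = "a n"] by (simp only: diff_Suc_1 mult.assoc)
  qed
qed

theorem sum_nat_flows:
  fixes q :: "'a::idom"
  assumes "shifted n r" "q \<noteq> 1" "\<And>i. 1 \<le> i \<Longrightarrow> i \<le> n \<Longrightarrow> a i > 0"
  shows "(\<Sum>x\<in>nat_flows n r a. \<Prod>e\<in>shifted_edges n r. shifted_wt q r x e) =
    (q - 1) ^ (2 * n) * (\<Prod>i\<in>{1..n}. shifted_factor q n r a i)"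
  using assms(1,3)
proof (induction n arbitrary: a)
  case 0
  then have E: "shifted_edges 0 r = {}" by (auto simp: shifted_def shifted_edges_def)
  then have "nat_flows 0 r a = {\<lambda>_. undefined}" by (auto simp: nat_flows_def)
  then show ?case by (simp add: E)
next
  case (Suc n)
  let ?m = "r (Suc n)"
  \<comment> \<open>Added inflow keeps the supplies positive, so the induction hypothesis applies
    for every \<open>f\<close>.\<close>
  have IH: "(\<Sum>y\<in>nat_flows n r (add_inflow ?m a f). \<Prod>e\<in>shifted_edges n r. shifted_wt q r y e) =
    (q - 1) ^ (2 * n) * (\<Prod>i\<in>{1..n}. shifted_factor q n r (add_inflow ?m a f) i)" for f
    using Suc.prems shifted_Suc[OF Suc.prems(1)] by (intro Suc.IH) auto
  have pos: "a (Suc n) > 0" using Suc.prems by simp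
  have "(\<Sum>x\<in>nat_flows (Suc n) r a. \<Prod>e\<in>shifted_edges (Suc n) r. shifted_wt q r x e) =
    (q - 1) ^ (2 * n) * (\<Sum>f\<in>compositions ?m (a (Suc n)).
      (\<Prod>k<?m. reduced_wt q (f k) * q ^ ((?m - 1 - k) * f k)) *
      (\<Prod>i\<in>{1..n}. shifted_factor q n r (add_inflow ?m a f) i))"
    unfolding sum_nat_flows_Suc[OF Suc.prems(1)] IH sum_distrib_left by (simp only: mult_ac)
  also have "\<dots> = (q - 1) ^ (2 * n) * ((q - 1) ^ 2 * (\<Prod>i\<in>{1..Suc n}. shifted_factor q (Suc n) r a i))"
    unfolding composition_sum_shifted_factor[where a = a, OF Suc.prems(1) \<open>q \<noteq> 1\<close> pos] ..
  finally show ?case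
    by (simp only: mult.assoc[symmetric] power_add[symmetric]) (simp add: mult.assoc add.commute)
qed

section \<open>From weighted flows to the Ehrhart sum\<close>

lemma sum_shifted_edges_out: "(\<Sum>(i, j)\<in>shifted_edges n r. g i j) = (\<Sum>i\<le>n. \<Sum>j<r i. g i j)"
  by (simp add: shifted_edges_def sum.Sigma)

lemma sum_shifted_edges_in:
  assumes "shifted n r"
  shows "(\<Sum>(i, j)\<in>shifted_edges n r. g i j) = (\<Sum>j\<le>n. \<Sum>i\<in>in_nbrs n r j. g i j)"
proof -
  have "{..<r i} = {j \<in> {..n}. j < r i}" if "i \<le> n" for i
    using shifted_le[OF assms that] that by auto
  then have "(\<Sum>(i, j)\<in>shifted_edges n r. g i j) = (\<Sum>i\<le>n. \<Sum>j | j \<in> {..n} \<and> j < r i. g i j)"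
    unfolding sum_shifted_edges_out by (intro sum.cong) auto
  also have "\<dots> = (\<Sum>j\<le>n. \<Sum>i | i \<in> {..n} \<and> j < r i. g i j)"
    by (rule sum.swap_restrict) auto
  finally show ?thesis by (simp add: in_nbrs_def)
qed

lemma sum_atMost_split: "(\<Sum>k\<le>n. g k) = g 0 + (\<Sum>k=1..n. g k)" for g :: "nat \<Rightarrow> 'b::comm_monoid_add"
  by (simp add: sum.atLeast_Suc_atMost atMost_atLeast0)

text \<open>Take \<open>r\<close> as a potential. By conservation, the drops
  \<open>(r i - r j) * x (i, j)\<close> add up to the left-hand side, and \<open>r j = j\<close> at
  every head, so \<open>r i - r j = 1 + (r i - 1 - j)\<close>. Hence the total power of
  \<open>q\<close> is the same for all flows.\<close>

lemma nat_flows_potential: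
  assumes sh: "shifted n r" and x: "x \<in> nat_flows n r a"
  shows "(\<Sum>i=1..n. r i * a i) =
    (\<Sum>e\<in>shifted_edges n r. x e) + (\<Sum>(i, j)\<in>shifted_edges n r. (r i - 1 - j) * x (i, j))"
proof -
  let ?E = "shifted_edges n r"
  have r0: "r 0 = 0" using shifted_le[OF sh, of 0] by simp
  have "(\<Sum>(i, j)\<in>?E. r i * x (i, j)) = (\<Sum>k=1..n. r k * (\<Sum>j<r k. x (k, j)))"
    unfolding sum_shifted_edges_out sum_atMost_split by (simp add: r0 sum_distrib_left)
  also have "\<dots> = (\<Sum>k=1..n. r k * a k + r k * (\<Sum>i\<in>in_nbrs n r k. x (i, k)))"
    using x by (intro sum.cong) (auto simp: nat_flows_def distrib_left)
  also have "\<dots> = (\<Sum>k=1..n. r k * a k) + (\<Sum>(i, j)\<in>?E. r j * x (i, j))"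
    unfolding sum_shifted_edges_in[OF sh] sum_atMost_split by (simp add: r0 sum_distrib_left sum.distrib)
  finally have "(\<Sum>(i, j)\<in>?E. r i * x (i, j)) = (\<Sum>k=1..n. r k * a k) + (\<Sum>(i, j)\<in>?E. r j * x (i, j))" .
  moreover have "(\<Sum>(i, j)\<in>?E. r i * x (i, j)) =
      (\<Sum>e\<in>?E. x e) + (\<Sum>(i, j)\<in>?E. (r i - 1 - j) * x (i, j)) + (\<Sum>(i, j)\<in>?E. r j * x (i, j))"
    unfolding sum.distrib[symmetric]
  proof (rule sum.cong)
    fix e assume "e \<in> ?E"
    then obtain i j where e: "e = (i, j)" "i \<le> n" "j < r i" by (auto simp: shifted_edges_def)
    then have "r j = j" using shifted_out_eq[OF sh] by blast
    then have "r i = 1 + (r i - 1 - j) + r j" using e by simp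
    then have "r i * x (i, j) = (1 + (r i - 1 - j) + r j) * x (i, j)" by simp
    then show "(case e of (i, j) \<Rightarrow> r i * x (i, j)) = x e + (case e of (i, j) \<Rightarrow> (r i - 1 - j) * x (i, j)) +
        (case e of (i, j) \<Rightarrow> r j * x (i, j))"
      unfolding e by (simp only: distrib_right prod.case mult_1_left)
  qed simp
  ultimately show ?thesis by simp
qed

lemma net_flow_shifted_edges:
  "k \<le> n \<Longrightarrow> net_flow (shifted_edges n r) x k =
    (\<Sum>j<r k. x (k, j)) - (\<Sum>i\<in>in_nbrs n r k. x (i, k))"
  by (simp add: net_flow_def shifted_edges_def in_nbrs_def lessThan_def)

text \<open>Each edge counts once as outgoing and once as incoming.\<close>

lemma sum_net_flow:
  assumes "shifted n r"
  shows "(\<Sum>k\<le>n. net_flow (shifted_edges n r) x k) = 0"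
proof -
  have "(\<Sum>k\<le>n. net_flow (shifted_edges n r) x k) =
      (\<Sum>k\<le>n. \<Sum>j<r k. x (k, j)) - (\<Sum>k\<le>n. \<Sum>i\<in>in_nbrs n r k. x (i, k))"
    by (simp add: net_flow_shifted_edges sum_subtractf)
  then show ?thesis
    using sum_shifted_edges_in[OF assms, of "\<lambda>i j. x (i, j)"] sum_shifted_edges_out[of "\<lambda>i j. x (i, j)" n r]
    by simp
qed

definition real_flow :: "('e \<Rightarrow> nat) \<Rightarrow> 'e set \<Rightarrow> 'e \<Rightarrow> real" where
  "real_flow x D = restrict (\<lambda>e. real (x e)) D"

lemma real_flow_apply [simp]: "e \<in> D \<Longrightarrow> real_flow x D e = real (x e)"
  by (simp add: real_flow_def)

lemma net_flow_real_flow: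
  assumes "k \<le> n"
  shows "net_flow (shifted_edges n r) (real_flow x (shifted_edges n r)) k =
    real (\<Sum>j<r k. x (k, j)) - real (\<Sum>i\<in>in_nbrs n r k. x (i, k))"
proof -
  have "(k, j) \<in> shifted_edges n r" if "j < r k" for j
    using that assms by (simp add: shifted_edges_def)
  moreover have "(i, k) \<in> shifted_edges n r" if "i \<in> in_nbrs n r k" for i
    using that by (simp add: shifted_edges_def in_nbrs_def)
  ultimately show ?thesis
    by (simp add: net_flow_shifted_edges[OF assms])
qed

text \<open>Taking floors inverts the map on nonnegative integral points; the balance at 0 comes
  from \<open>sum_net_flow\<close>.\<close>

lemma bij_betw_real_flow:
  assumes sh: "shifted n r"
  defines "D \<equiv> shifted_edges n r"
  shows "bij_betw (\<lambda>x. real_flow x D) (nat_flows n r a)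
    (flow_polytope n D (\<lambda>i. real (a i)) \<inter> (D \<rightarrow>\<^sub>E \<int>))"
proof -
  have conserve: "net_flow D (real_flow x D) k = real (a k) \<longleftrightarrow>
      (\<Sum>j<r k. x (k, j)) = a k + (\<Sum>i\<in>in_nbrs n r k. x (i, k))" if "k \<in> {1..n}" for x k
  proof -
    have "net_flow D (real_flow x D) k = real (a k) \<longleftrightarrow>
      real (\<Sum>j<r k. x (k, j)) = real (a k + (\<Sum>i\<in>in_nbrs n r k. x (i, k)))"
      unfolding D_def using that by (subst net_flow_real_flow) auto
    then show ?thesis by (simp only: of_nat_eq_iff)
  qed
  show ?thesis
    unfolding bij_betw_def
  proof
    show "inj_on (\<lambda>x. real_flow x D) (nat_flows n r a)"
    proof (rule inj_onI)
      fix x y assume x: "x \<in> nat_flows n r a" and y: "y \<in> nat_flows n r a"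
        and eq: "real_flow x D = real_flow y D"
      have "x e = y e" if "e \<in> D" for e
        using fun_cong[OF eq, of e] that by simp
      then show "x = y"
        using x y by (intro PiE_ext[of x D "\<lambda>_. UNIV"]) (auto simp: nat_flows_def D_def)
    qed
    show "(\<lambda>x. real_flow x D) ` nat_flows n r a = flow_polytope n D (\<lambda>i. real (a i)) \<inter> (D \<rightarrow>\<^sub>E \<int>)"
    proof (intro equalityI subsetI)
      fix z assume "z \<in> (\<lambda>x. real_flow x D) ` nat_flows n r a"
      then obtain x where z: "z = real_flow x D" and x: "x \<in> nat_flows n r a" by blast
      have net: "net_flow D z k = real (a k)" if "k \<in> {1..n}" for k
        using conserve[OF that, of x] x that by (simp add: z nat_flows_def)
      moreover have "net_flow D z 0 = - (\<Sum>i=1..n. real (a i))"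
        using sum_net_flow[OF sh, of z] net unfolding sum_atMost_split D_def by simp
      moreover have "z \<in> D \<rightarrow>\<^sub>E {0..}" "z \<in> D \<rightarrow>\<^sub>E \<int>"
        by (auto simp: z real_flow_def)
      ultimately show "z \<in> flow_polytope n D (\<lambda>i. real (a i)) \<inter> (D \<rightarrow>\<^sub>E \<int>)"
        by (simp add: flow_polytope_def)
    next
      fix z assume z: "z \<in> flow_polytope n D (\<lambda>i. real (a i)) \<inter> (D \<rightarrow>\<^sub>E \<int>)"
      define x where "x = restrict (\<lambda>e. nat \<lfloor>z e\<rfloor>) D"
      have "real (x e) = z e" if "e \<in> D" for e
      proof -
        have "z e \<ge> 0" "z e \<in> \<int>"
          using z that by (auto simp: flow_polytope_def PiE_iff)
        then show ?thesis using that by (auto simp: x_def elim!: Ints_cases)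
      qed
      then have zx: "z = real_flow x D"
        using z by (auto simp: fun_eq_iff real_flow_def PiE_iff extensional_def)
      moreover have "x \<in> nat_flows n r a"
      proof -
        have "net_flow D (real_flow x D) k = real (a k)" if "k \<in> {1..n}" for k
          using z that zx by (auto simp: flow_polytope_def)
        then show ?thesis using conserve by (auto simp: nat_flows_def x_def D_def)
      qed
      ultimately show "z \<in> (\<lambda>x. real_flow x D) ` nat_flows n r a" by blast
    qed
  qed
qed

text \<open>Extracting powers of \<open>inverse q\<close> from both differences gives the edge
  weight \<open>q * inverse q ^ b * qint (q ^ 2) b\<close>; the extra \<open>q\<close> completes the
  constant to \<open>(q - 1) ^ 2\<close>.\<close>

lemma edge_wt_reduced_wt:
  fixes q :: "'a::field"
  assumes "q \<noteq> 0" "q \<noteq> inverse q" "b > 0"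
  shows "- ((1 - inverse q) * (1 - q)) * edge_wt q (inverse q) b = inverse q ^ b * reduced_wt q b"
proof -
  let ?t = "inverse q"
  have nz: "q\<^sup>2 - 1 \<noteq> 0"
    using assms by (auto simp: power2_eq_square field_simps)
  have qt: "q - ?t = ?t * (q\<^sup>2 - 1)"
    using assms(1) by (simp add: power2_eq_square field_simps)
  have "q ^ b - ?t ^ b = ?t ^ b * ((q\<^sup>2) ^ b - 1)"
    using assms(1) by (simp add: power_mult[symmetric] field_simps power2_eq_square mult_2 power_add)
  also have "\<dots> = ?t ^ b * ((q\<^sup>2 - 1) * qint (q\<^sup>2) b)"
    by (simp add: qint_geometric)
  finally have "edge_wt q ?t b = q * (?t ^ b * qint (q\<^sup>2) b)"
    unfolding edge_wt_def qt using nz assms by (simp add: divide_simps)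
  moreover have "- ((1 - ?t) * (1 - q)) * q = (q - 1)\<^sup>2"
    using assms(1) by (simp add: power2_eq_square field_simps)
  ultimately show ?thesis
    using assms(3) by (simp add: reduced_wt_def mult.assoc[symmetric])
qed

text \<open>The count of positive entries in the exponent hands one constant to each such edge; the
  power \<open>n\<close> on the left cancels the rest.\<close>

lemma flow_wt_real_flow:
  fixes q :: "'a::field"
  assumes "q \<noteq> 0" "q \<noteq> inverse q" "finite D"
  shows "flow_wt q (inverse q) n D (real_flow x D) * (- ((1 - inverse q) * (1 - q))) ^ n =
    inverse q ^ (\<Sum>e\<in>D. x e) * (\<Prod>e\<in>D. reduced_wt q (x e))"
proof -
  let ?w = "edge_wt q (inverse q)"
  define c where "c = - ((1 - inverse q) * (1 - q))"
  have "q \<noteq> 1" using assms(2) by auto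
  then have "c \<noteq> 0" using assms(1) by (auto simp: c_def)
  have "{e \<in> D. real_flow x D e > 0} = {e \<in> D. x e > 0}"
    by auto
  then have "c ^ card {e \<in> D. real_flow x D e > 0} = (\<Prod>e\<in>D. if x e > 0 then c else 1)"
    using assms(3) by (simp add: prod.If_cases Int_def)
  moreover have "(\<Prod>e\<in>D. ?w (nat \<lfloor>real_flow x D e\<rfloor>)) = (\<Prod>e\<in>D. ?w (x e))"
    by (rule prod.cong) auto
  ultimately have "flow_wt q (inverse q) n D (real_flow x D) * c ^ n = (\<Prod>e\<in>D. (if x e > 0 then c else 1) * ?w (x e))"
    using \<open>c \<noteq> 0\<close> unfolding flow_wt_def c_def[symmetric]
    by (simp add: power_int_diff prod.distrib)
  also have "\<dots> = (\<Prod>e\<in>D. inverse q ^ x e * reduced_wt q (x e))"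
  proof (rule prod.cong)
    fix e
    show "(if x e > 0 then c else 1) * ?w (x e) = inverse q ^ x e * reduced_wt q (x e)"
      using edge_wt_reduced_wt[OF assms(1,2), of "x e"]
      by (cases "x e = 0") (simp_all add: c_def edge_wt_def[of _ _ 0] reduced_wt_def[of _ 0])
  qed simp
  finally show ?thesis
    by (simp add: c_def prod.distrib power_sum)
qed

text \<open>After multiplication by \<open>c ^ n\<close> all flows share the factor
  \<open>inverse q ^ W\<close>, and \<open>sum_nat_flows\<close> evaluates what remains. Since
  \<open>c * q = (q - 1) ^ 2\<close>, cancelling \<open>c ^ n\<close> leaves
  \<open>q ^ n\<close>.\<close>

theorem Ehr_shifted_edges:
  fixes q :: "'a::field"
  assumes sh: "shifted n r" and a_pos: "\<And>i. 1 \<le> i \<Longrightarrow> i \<le> n \<Longrightarrow> a i > 0"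
    and q: "q \<noteq> 0" "q \<noteq> inverse q"
  shows "Ehr q (inverse q) n (shifted_edges n r) (\<lambda>i. real (a i)) =
    q ^ n * inverse q ^ (\<Sum>i=1..n. r i * a i) * (\<Prod>i=1..n. shifted_factor q n r a i)"
proof -
  let ?E = "shifted_edges n r"
  define W where "W = (\<Sum>i=1..n. r i * a i)"
  define c where "c = - ((1 - inverse q) * (1 - q))"
  have "q \<noteq> 1" using q(2) by auto
  then have "c \<noteq> 0" using q(1) by (auto simp: c_def)
  have cq: "c * q = (q - 1)\<^sup>2"
    using q(1) by (simp add: c_def power2_eq_square field_simps)
  have wt: "flow_wt q (inverse q) n ?E (real_flow x ?E) * c ^ n =
      inverse q ^ W * (\<Prod>e\<in>?E. shifted_wt q r x e)" if "x \<in> nat_flows n r a" for x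
  proof -
    let ?V = "\<Sum>(i, j)\<in>?E. (r i - 1 - j) * x (i, j)"
    have "W = (\<Sum>e\<in>?E. x e) + ?V"
      unfolding W_def by (rule nat_flows_potential[OF sh that])
    then have 1: "inverse q ^ W * q ^ ?V = inverse q ^ (\<Sum>e\<in>?E. x e)"
      using q(1) by (simp add: power_add power_mult_distrib[symmetric] mult.assoc)
    have 2: "(\<Prod>e\<in>?E. shifted_wt q r x e) = (\<Prod>e\<in>?E. reduced_wt q (x e)) * q ^ ?V"
      by (simp add: power_sum prod.distrib[symmetric] shifted_wt_def case_prod_unfold)
    have 3: "flow_wt q (inverse q) n ?E (real_flow x ?E) * c ^ n =
      inverse q ^ (\<Sum>e\<in>?E. x e) * (\<Prod>e\<in>?E. reduced_wt q (x e))"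
      unfolding c_def using q by (rule flow_wt_real_flow) simp
    show ?thesis
      unfolding 3 2 1[symmetric] by (simp only: mult_ac)
  qed
  have "Ehr q (inverse q) n ?E (\<lambda>i. real (a i)) =
      (\<Sum>x\<in>nat_flows n r a. flow_wt q (inverse q) n ?E (real_flow x ?E))"
    unfolding Ehr_def by (rule sum.reindex_bij_betw[OF bij_betw_real_flow[OF sh], symmetric])
  then have "Ehr q (inverse q) n ?E (\<lambda>i. real (a i)) * c ^ n =
      inverse q ^ W * (\<Sum>x\<in>nat_flows n r a. \<Prod>e\<in>?E. shifted_wt q r x e)"
    by (simp add: sum_distrib_left sum_distrib_right wt)
  also have "\<dots> = inverse q ^ W * ((c * q) ^ n * (\<Prod>i=1..n. shifted_factor q n r a i))"
    unfolding cq power_mult[symmetric] using sum_nat_flows[OF sh \<open>q \<noteq> 1\<close> a_pos] by simp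
  also have "\<dots> = q ^ n * inverse q ^ W * (\<Prod>i=1..n. shifted_factor q n r a i) * c ^ n"
    by (simp add: power_mult_distrib)
  finally show ?thesis using \<open>c \<noteq> 0\<close> by (simp add: W_def)
qed

section \<open>Threshold graphs\<close>

lemma threshold_graph_edge:
  "threshold_graph V E \<Longrightarrow> e \<in> E \<Longrightarrow> \<exists>u\<in>V. \<exists>v\<in>V. u \<noteq> v \<and> e = {u, v}"
proof (induction arbitrary: e rule: threshold_graph.induct)
  case (isolated V E v)
  then show ?case by (meson insertI2)
next
  case (dominating V E v)
  show ?case
  proof (cases "e \<in> E")
    case True
    then show ?thesis using dominating.IH by (meson insertI2)
  next
    case False
    then obtain u where "u \<in> V" "e = {u, v}" using dominating.prems by blast
    then show ?thesis using dominating.hyps(2) by (metis insertI1 insertI2)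
  qed
qed simp

text \<open>Up to the two vertices compared, neighbourhoods form a chain: a new isolated vertex is
  lowest, a new dominating one highest, and neither disturbs the order of the old ones.\<close>

lemma threshold_graph_nested:
  assumes "threshold_graph V E" "u \<in> V" "v \<in> V"
  shows "(\<forall>w. w \<noteq> v \<longrightarrow> {u, w} \<in> E \<longrightarrow> {v, w} \<in> E) \<or> (\<forall>w. w \<noteq> u \<longrightarrow> {v, w} \<in> E \<longrightarrow> {u, w} \<in> E)"
  using assms
proof (induction arbitrary: u v rule: threshold_graph.induct)
  case (single x)
  then show ?case by simp
next
  case (isolated V E x)
  have "{x, w} \<notin> E" for w
    using threshold_graph_edge[OF isolated.hyps(1)] isolated.hyps(2) by (metis doubleton_eq_iff)
  then show ?case using isolated.IH[of u v] isolated.prems by auto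
next
  case (dominating V E x)
  define E' where "E' = E \<union> {{y, x} |y. y \<in> V}"
  have "{x, w} \<notin> E" for w
    using threshold_graph_edge[OF dominating.hyps(1)] dominating.hyps(2) by (metis doubleton_eq_iff)
  then have x: "{x, w} \<in> E' \<longleftrightarrow> w \<in> V" for w
    unfolding E'_def using dominating.hyps(2) by (auto simp: doubleton_eq_iff)
  have old: "{u, w} \<in> E' \<longleftrightarrow> {u, w} \<in> E \<or> w = x" if "u \<in> V" for u w
    unfolding E'_def using that dominating.hyps(2) by (auto simp: doubleton_eq_iff)
  have nbr: "w \<in> V" if "{u, w} \<in> E" for u w
    using threshold_graph_edge[OF dominating.hyps(1) that] by (auto simp: doubleton_eq_iff)
  have dom: "\<forall>w. w \<noteq> x \<longrightarrow> {u, w} \<in> E' \<longrightarrow> {x, w} \<in> E'" if "u \<in> insert x V" for u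
    using that old[of u] nbr[of u] x by blast
  show ?case
    unfolding E'_def[symmetric]
  proof (cases "u = x \<or> v = x")
    case True
    then show "(\<forall>w. w \<noteq> v \<longrightarrow> {u, w} \<in> E' \<longrightarrow> {v, w} \<in> E') \<or>
        (\<forall>w. w \<noteq> u \<longrightarrow> {v, w} \<in> E' \<longrightarrow> {u, w} \<in> E')"
      using dom dominating.prems by blast
  next
    case False
    then have uv: "u \<in> V" "v \<in> V" using dominating.prems by auto
    show "(\<forall>w. w \<noteq> v \<longrightarrow> {u, w} \<in> E' \<longrightarrow> {v, w} \<in> E') \<or>
        (\<forall>w. w \<noteq> u \<longrightarrow> {v, w} \<in> E' \<longrightarrow> {u, w} \<in> E')"
      using dominating.IH[OF uv] unfolding old[OF uv(1)] old[OF uv(2)] by blast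
  qed
qed

lemma vertex_degree_card_nbrs:
  assumes "\<And>e. e \<in> E \<Longrightarrow> \<exists>u\<in>V. \<exists>v\<in>V. u \<noteq> v \<and> e = {u, v}"
  shows "vertex_degree E v = card {w. {v, w} \<in> E}"
proof -
  have "bij_betw (\<lambda>w. {v, w}) {w. {v, w} \<in> E} {e \<in> E. v \<in> e}"
    unfolding bij_betw_def
  proof
    show "inj_on (\<lambda>w. {v, w}) {w. {v, w} \<in> E}"
      by (auto simp: inj_on_def doubleton_eq_iff)
    show "(\<lambda>w. {v, w}) ` {w. {v, w} \<in> E} = {e \<in> E. v \<in> e}"
    proof (intro equalityI subsetI)
      fix e assume e: "e \<in> {e \<in> E. v \<in> e}"
      then obtain w where "e = {v, w}" using assms[of e] by auto
      then show "e \<in> (\<lambda>w. {v, w}) ` {w. {v, w} \<in> E}" using e by auto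
    qed auto
  qed
  from bij_betw_same_card[OF this] show ?thesis
    by (simp add: vertex_degree_def)
qed

text \<open>The nesting must follow the degrees. Otherwise, apart from \<open>u\<close> and
  \<open>v\<close> themselves, \<open>u\<close> would have strictly fewer neighbours than
  \<open>v\<close>, and adjacency of \<open>u\<close> and \<open>v\<close> counts equally for
  both.\<close>

lemma threshold_graph_degree_sorted:
  assumes th: "threshold_graph V E" and fin: "finite V" and "u \<in> V" "v \<in> V"
    and deg: "vertex_degree E v \<le> vertex_degree E u" and "w \<noteq> u" "{v, w} \<in> E"
  shows "{u, w} \<in> E"
proof (rule ccontr)
  assume not: "{u, w} \<notin> E"
  have edge: "\<And>e. e \<in> E \<Longrightarrow> \<exists>u\<in>V. \<exists>v\<in>V. u \<noteq> v \<and> e = {u, v}"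
    using threshold_graph_edge[OF th] .
  have loop: "{x} \<notin> E" for x
    using edge by (metis doubleton_eq_iff insert_absorb2)
  let ?N = "\<lambda>x. {w. {x, w} \<in> E}"
  have finN: "finite (?N x)" for x
    using edge by (intro finite_subset[OF _ fin]) (force simp: doubleton_eq_iff)
  have "\<forall>w. w \<noteq> v \<longrightarrow> {u, w} \<in> E \<longrightarrow> {v, w} \<in> E"
    using threshold_graph_nested[OF th assms(3,4)] assms(6,7) not by blast
  moreover have "w \<noteq> v" using assms(7) loop by auto
  ultimately have "?N u - {v} \<subset> ?N v - {u}"
    using assms(6,7) not loop by (auto simp: psubset_eq)
  then have "card (?N u - {v}) < card (?N v - {u})"
    using finN by (intro psubset_card_mono) auto
  moreover have "v \<in> ?N u \<longleftrightarrow> u \<in> ?N v" by (simp add: insert_commute)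
  ultimately have "card (?N u) < card (?N v)"
    using finN by (cases "v \<in> ?N u") (auto simp: card_Diff_singleton)
  then show False
    using deg vertex_degree_card_nbrs[of E V] edge by (metis leD)
qed

lemma initial_segment_nat:
  fixes A :: "nat set"
  assumes "finite A" "\<And>i j. j \<in> A \<Longrightarrow> i < j \<Longrightarrow> i \<in> A"
  shows "A = {..<card A}"
proof (cases "A = {}")
  case False
  define M where "M = Max A"
  have M: "M \<in> A" "\<And>i. i \<in> A \<Longrightarrow> i \<le> M"
    using assms(1) False by (simp_all add: M_def)
  have "i \<in> A \<longleftrightarrow> i < Suc M" for i
    using M(2)[of i] M(1) assms(2)[of M i] by (auto simp: less_Suc_eq_le le_less)
  then have "A = {..<Suc M}" by blast
  then show ?thesis by simp
qed simp

text \<open>Sortedness lets an endpoint of an edge move to any smaller vertex other than the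
  opposite endpoint. Moving the lower one shows that out-neighbourhoods are initial segments, moving
  the upper one that they are shifted.\<close>

lemma threshold_graph_shifted:
  assumes th: "threshold_graph {0..n} E"
    and sorted: "\<And>i j. i < j \<Longrightarrow> j \<le> n \<Longrightarrow> vertex_degree E j \<le> vertex_degree E i"
  obtains r where "shifted n r" "directed_edges E = shifted_edges n r"
    "\<And>i. i \<le> n \<Longrightarrow> vertex_degree E i = r i + card (in_nbrs n r i)"
proof -
  have shift: "{i, w} \<in> E" if "{j, w} \<in> E" "i < j" "j \<le> n" "w \<noteq> i" for i j w
    using threshold_graph_degree_sorted[OF th, of i j w] sorted[of i j] that by simp
  have edge: "\<And>e. e \<in> E \<Longrightarrow> \<exists>u\<in>{0..n}. \<exists>v\<in>{0..n}. u \<noteq> v \<and> e = {u, v}"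
    using threshold_graph_edge[OF th] .
  have le_n: "i \<le> n \<and> j \<le> n \<and> i \<noteq> j" if "{i, j} \<in> E" for i j
    using edge[OF that] by (auto simp: doubleton_eq_iff)
  define O' where "O' i = {j. j < i \<and> {i, j} \<in> E}" for i
  define r where "r i = card (O' i)" for i
  have finO: "finite (O' i)" for i unfolding O'_def by simp
  have O': "O' i = {..<r i}" for i
    unfolding r_def
  proof (rule initial_segment_nat[OF finO])
    fix j k assume "j \<in> O' i" "k < j"
    then show "k \<in> O' i"
      using shift[of j i k] le_n[of i j] by (auto simp: O'_def insert_commute)
  qed
  have adj: "j < r i \<longleftrightarrow> j < i \<and> {i, j} \<in> E" for i j
    using O'[of i] unfolding O'_def by auto
  have "shifted n r"
    unfolding shifted_def
  proof (intro conjI allI impI)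
    fix i show "r i \<le> i"
      using adj[of i i] by simp
  next
    fix i k assume "i \<le> n" "k < i"
    show "min (r i) k \<le> r k"
    proof (rule ccontr)
      assume "\<not> min (r i) k \<le> r k"
      \<comment> \<open>The vertex \<open>r k\<close> is the first one that \<open>k\<close> misses,
        yet \<open>i\<close> reaches it.\<close>
      then have "r k < r i" "r k < k" by auto
      then have "{i, r k} \<in> E" using adj by blast
      then have "{k, r k} \<in> E"
        using shift[of i "r k" k] \<open>i \<le> n\<close> \<open>k < i\<close> \<open>r k < k\<close> by simp
      then show False using adj[of "r k" k] \<open>r k < k\<close> by simp
    qed
  qed
  moreover have "directed_edges E = shifted_edges n r"
    unfolding directed_edges_def shifted_edges_def using le_n by (auto simp: adj)
  moreover have "vertex_degree E i = r i + card (in_nbrs n r i)" if "i \<le> n" for i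
  proof -
    have "{w. {i, w} \<in> E} = O' i \<union> in_nbrs n r i"
      using le_n[of i] unfolding O'_def in_nbrs_def adj by (auto simp: insert_commute neq_iff)
    moreover have "O' i \<inter> in_nbrs n r i = {}"
      unfolding O'_def in_nbrs_def adj by auto
    ultimately show ?thesis
      using vertex_degree_card_nbrs[of E "{0..n}" i] edge finO
      by (simp add: card_Un_disjoint r_def)
  qed
  ultimately show thesis by (rule that)
qed

text \<open>Shiftedness fills the gap between \<open>i\<close> and its largest in-neighbour. This
  yields the summation range up to \<open>d i\<close> in \<open>b_factor\<close>.\<close>

lemma in_nbrs_interval:
  assumes sh: "shifted n r"
  shows "in_nbrs n r i = {i<..i + card (in_nbrs n r i)}"
proof (cases "in_nbrs n r i = {}")
  case False
  let ?I = "in_nbrs n r i"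
  define M where "M = Max ?I"
  have M: "M \<in> ?I" using False unfolding M_def by (intro Max_in) auto
  have "k \<in> ?I \<longleftrightarrow> i < k \<and> k \<le> M" for k
  proof
    assume k: "k \<in> ?I"
    then show "i < k \<and> k \<le> M"
      using shifted_le[OF sh, of k] by (auto simp: in_nbrs_def M_def intro!: Max_ge)
  next
    assume k: "i < k \<and> k \<le> M"
    show "k \<in> ?I"
    proof (cases "k = M")
      case False
      then have "min (r M) k \<le> r k"
        using sh M k by (simp add: shifted_def in_nbrs_def)
      then show ?thesis using M k by (auto simp: in_nbrs_def)
    qed (use M in simp)
  qed
  then have I: "?I = {i<..M}" by (intro set_eqI) simp
  then have "card ?I = M - i" by (metis card_greaterThanAtMost)
  moreover have "i < M" using M I by auto
  ultimately show ?thesis using I by simp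
qed simp

text \<open>An in-neighbour forces \<open>r i = i\<close> and hence \<open>d i > i\<close>; without
  one, \<open>d i = r i \<le> i\<close>. Thus the degree selects the matching case.\<close>

lemma b_factor_shifted:
  assumes sh: "shifted n r" and "i \<le> n" and d: "d i = r i + card (in_nbrs n r i)"
  shows "b_factor q d a i = shifted_factor q n r a i" "min (d i) i = r i"
proof -
  have le: "r i \<le> i" using shifted_le[OF sh assms(2)] .
  have "b_factor q d a i = shifted_factor q n r a i \<and> min (d i) i = r i"
  proof (cases "in_nbrs n r i = {}")
    case True
    then show ?thesis using le d by (auto simp: b_factor_def shifted_factor_def)
  next
    case False
    then obtain k where "k \<le> n" "i < r k" by (auto simp: in_nbrs_def)
    then have r: "r i = i" using shifted_out_eq[OF sh] by blast
    moreover have "card (in_nbrs n r i) > 0" using False by (simp add: card_gt_0_iff)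
    ultimately have gt: "d i > i" using d by simp
    have I: "in_nbrs n r i = {i + 1..d i}"
      by (subst in_nbrs_interval[OF sh]) (auto simp: d r)
    show ?thesis using False gt r unfolding b_factor_def shifted_factor_def I by simp
  qed
  then show "b_factor q d a i = shifted_factor q n r a i" "min (d i) i = r i" by auto
qed

theorem theorem5p2:
  fixes n :: nat and E :: "nat set set" and d a :: "nat \<Rightarrow> nat" and F :: int and q :: "'a::field"
  assumes threshold: "threshold_graph {0..n} E"
    and deg: "\<And>i. i \<le> n \<Longrightarrow> d i = vertex_degree E i"
    and reverse_degree: "\<And>i j. i < j \<Longrightarrow> j \<le> n \<Longrightarrow> d i \<ge> d j"
    and a_pos: "\<And>i. 1 \<le> i \<Longrightarrow> i \<le> n \<Longrightarrow> a i > 0"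
    and q_nonzero: "q \<noteq> 0"
    and q_generic: "q \<noteq> inverse q"
    and F: "F = (\<Sum>i=1..n. int (min (d i) i * a i)) - int n"
  shows "Ehr q (inverse q) n (directed_edges E) (\<lambda>i. real (a i)) =
    q powi (- F) * (\<Prod>i=1..n. b_factor q d a i)"
proof -
  have sorted: "vertex_degree E j \<le> vertex_degree E i" if "i < j" "j \<le> n" for i j
    using reverse_degree[OF that] deg[of i] deg[of j] that by simp
  obtain r where sh: "shifted n r" and D: "directed_edges E = shifted_edges n r"
    and vd: "\<And>i. i \<le> n \<Longrightarrow> vertex_degree E i = r i + card (in_nbrs n r i)"
    using threshold_graph_shifted[OF threshold sorted] by blast
  have d: "d i = r i + card (in_nbrs n r i)" if "i \<le> n" for i
    using deg[OF that] vd[OF that] by simp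
  define W where "W = (\<Sum>i=1..n. r i * a i)"
  have "F = int W - int n"
    unfolding F W_def of_nat_sum using b_factor_shifted(2)[of n r _ d, OF sh _ d]
    by (intro arg_cong2[where f = "(-)"] sum.cong) auto
  \<comment> \<open>The term \<open>- n\<close> in \<open>F\<close> accounts for the factor
    \<open>q ^ n\<close>.\<close>
  then have "q powi (- F) = q ^ n * inverse q ^ W"
    using q_nonzero by (simp add: power_int_diff divide_inverse power_inverse)
  moreover have "(\<Prod>i=1..n. b_factor q d a i) = (\<Prod>i=1..n. shifted_factor q n r a i)"
    by (intro prod.cong refl b_factor_shifted(1)[OF sh _ d]) auto
  ultimately show ?thesis
    using Ehr_shifted_edges[OF sh a_pos q_nonzero q_generic] by (simp add: D W_def)
qed

end
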